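(* Let $T:V\to\mathfrak g$ be an embedding tensor on a $3$-Lie algebra $(\mathfrak g,[\cdot,\cdot,\cdot]_{\mathfrak g})$ with respect to a representation $(V;\rho)$. Define linear maps $l_T,m_T,r_T:\otimes^2V\to\mathfrak{gl}(\mathfrak g)$ by $$l_T(u,v)(x)=[Tu,Tv,x]_{\mathfrak g},\qquad m_T(u,v)(x)=[Tu,x,Tv]_{\mathfrak g}-T(\rho(Tu,x)v),\qquad r_T=-m_T,$$ for all $u,v\in V$, $x\in\mathfrak g$. Then $(\mathfrak g;l_T,m_T,r_T)$ is a representation of the $3$-Leibniz algebra $(V,[\cdot,\cdot,\cdot]_T)$, where $[u,v,w]_T=\rho(Tu,Tv)w$.
   Context: All vector spaces are over an algebraically closed field $\mathbb K$ of characteristic $0$. A $3$-Lie algebra is a vector space $\mathfrak g$ with a skew-symmetric trilinear bracket $[\cdot,\cdot,\cdot]_{\mathfrak g}$ such that $[x_1,x_2,[x_3,x_4,x_5]_{\mathfrak g}]_{\mathfrak g}=[[x_1,x_2,x_3]_{\mathfrak g},x_4,x_5]_{\mathfrak g}+[x_3,[x_1,x_2,x_4]_{\mathfrak g},x_5]_{\mathfrak g}+[x_3,x_4,[x_1,x_2,x_5]_{\mathfrak g}]_{\mathfrak g}$ for all $x_i\in\mathfrak g$. A representation of a $3$-Lie algebra $\mathfrak g$ on a vector space $V$ is a linear map $\rho:\wedge^2\mathfrak g\to\mathfrak{gl}(V)$ such that for all $x_i\in\mathfrak g$: $\rho(x_1,x_2)\rho(x_3,x_4)=\rho([x_1,x_2,x_3]_{\mathfrak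 g},x_4)+\rho(x_3,[x_1,x_2,x_4]_{\mathfrak g})+\rho(x_3,x_4)\rho(x_1,x_2)$ and $\rho(x_1,[x_2,x_3,x_4]_{\mathfrak g})=\rho(x_3,x_4)\rho(x_1,x_2)-\rho(x_2,x_4)\rho(x_1,x_3)+\rho(x_2,x_3)\rho(x_1,x_4)$. An embedding tensor on $\mathfrak g$ with respect to $(V;\rho)$ is a linear map $T:V\to\mathfrak g$ with $[Tu,Tv,Tw]_{\mathfrak g}=T(\rho(Tu,Tv)w)$ for all $u,v,w\in V$. A $3$-Leibniz algebra is a vector space $\mathcal L$ with a trilinear bracket satisfying $[x_1,x_2,[y_1,y_2,y_3]]=[[x_1,x_2,y_1],y_2,y_3]+[y_1,[x_1,x_2,y_2],y_3]+[y_1,y_2,[x_1,x_2,y_3]]$. For an embedding tensor $T$, $(V,[\cdot,\cdot,\cdot]_T)$ is a $3$-Leibniz algebra. A representation of a $3$-Leibniz algebra $(\mathcal L,[\cdot,\cdot,\cdot])$ is a quadruple $(W;l,m,r)$ with $W$ a vector space and $l,m,r:\otimes^2\mathcal L\to\mathfrak{gl}(W)$ linear such that for all $x_1,\dots,x_4\in\mathcal L$: $l(x_1,x_2)l(x_3,x_4)=l([x_1,x_2,x_3],x_4)+l(x_3,[x_1,x_2,x_4])+l(x_3,x_4)l(x_1,x_2)$, $l(x_1,x_2)m(x_3,x_4)=m([x_1,x_2,x_3],x_4)+m(x_3,[x_1,x_2,x_4])+m(x_3,x_4)l(x_1,x_2)$, $l(x_1,x_2)r(x_3,x_4)=r([x_1,x_2,x_3],x_4)+r(x_3,[x_1,x_2,x_4])+r(x_3,x_4)l(x_1,x_2)$,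 $m(x_1,[x_2,x_3,x_4])=r(x_3,x_4)m(x_1,x_2)+m(x_2,x_4)m(x_1,x_3)+l(x_2,x_3)m(x_1,x_4)$, $r(x_1,[x_2,x_3,x_4])=r(x_3,x_4)r(x_1,x_2)+m(x_2,x_4)r(x_1,x_3)+l(x_2,x_3)r(x_1,x_4)$. *)

theory Defs
  imports Complex_Main "HOL-Computational_Algebra.Polynomial"
begin

text \<open>
  Vector spaces carry the sort of the ground field: algebraically closed of characteristic 0.
  A linear map from the second tensor power of \<open>L\<close> to \<open>gl(W)\<close> is encoded as the corresponding
  bilinear map, in curried form, with values in the linear endomorphisms of \<open>W\<close>.
\<close>

definition bilinear_to_gl ::
  "('k::{alg_closed_field,field_char_0} \<Rightarrow> 'l::ab_group_add \<Rightarrow> 'l) \<Rightarrow>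
   ('k \<Rightarrow> 'w::ab_group_add \<Rightarrow> 'w) \<Rightarrow> ('l \<Rightarrow> 'l \<Rightarrow> 'w \<Rightarrow> 'w) \<Rightarrow> bool" where
  "bilinear_to_gl sL sW f \<longleftrightarrow>
     (\<forall>x y. Vector_Spaces.linear sW sW (f x y)) \<and>
     (\<forall>y w. Vector_Spaces.linear sL sW (\<lambda>x. f x y w)) \<and>
     (\<forall>x w. Vector_Spaces.linear sL sW (\<lambda>y. f x y w))"

definition trilinear ::
  "('k::{alg_closed_field,field_char_0} \<Rightarrow> 'l::ab_group_add \<Rightarrow> 'l) \<Rightarrow>
   ('l \<Rightarrow> 'l \<Rightarrow> 'l \<Rightarrow> 'l) \<Rightarrow> bool" where
  "trilinear s b \<longleftrightarrow>
     (\<forall>y z. Vector_Spaces.linear s s (\<lambda>x. b x y z)) \<and>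
     (\<forall>x z. Vector_Spaces.linear s s (\<lambda>y. b x y z)) \<and>
     (\<forall>x y. Vector_Spaces.linear s s (\<lambda>z. b x y z))"

locale three_leibniz_algebra = vector_space scale
  for scale :: "'k::{alg_closed_field,field_char_0} \<Rightarrow> 'l::ab_group_add \<Rightarrow> 'l" +
  fixes bracket :: "'l \<Rightarrow> 'l \<Rightarrow> 'l \<Rightarrow> 'l"
  assumes trilinear: "trilinear scale bracket"
    and fundamental_identity:
      "bracket x1 x2 (bracket y1 y2 y3) =
         bracket (bracket x1 x2 y1) y2 y3 + bracket y1 (bracket x1 x2 y2) y3 +
         bracket y1 y2 (bracket x1 x2 y3)"

text \<open>
  Skew-symmetry is required for the two adjacent transpositions, which generate \<open>S\<^sub>3\<close>.
\<close>

locale three_lie_algebra = vector_space scale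
  for scale :: "'k::{alg_closed_field,field_char_0} \<Rightarrow> 'g::ab_group_add \<Rightarrow> 'g" +
  fixes bracket :: "'g \<Rightarrow> 'g \<Rightarrow> 'g \<Rightarrow> 'g"
  assumes trilinear: "trilinear scale bracket"
    and skew12: "bracket y x z = - bracket x y z"
    and skew23: "bracket x z y = - bracket x y z"
    and fundamental_identity:
      "bracket x1 x2 (bracket x3 x4 x5) =
         bracket (bracket x1 x2 x3) x4 x5 + bracket x3 (bracket x1 x2 x4) x5 +
         bracket x3 x4 (bracket x1 x2 x5)"

text \<open>
  A linear map on the second exterior power of \<open>g\<close> is encoded as the corresponding alternating bilinear map.
\<close>

locale three_lie_representation =
  three_lie_algebra scaleG bracket + V: vector_space scaleV
  for scaleG :: "'k::{alg_closed_field,field_char_0} \<Rightarrow> 'g::ab_group_add \<Rightarrow> 'g"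
    and bracket :: "'g \<Rightarrow> 'g \<Rightarrow> 'g \<Rightarrow> 'g"
    and scaleV :: "'k \<Rightarrow> 'v::ab_group_add \<Rightarrow> 'v" +
  fixes \<rho> :: "'g \<Rightarrow> 'g \<Rightarrow> 'v \<Rightarrow> 'v"
  assumes rho_bilinear: "bilinear_to_gl scaleG scaleV \<rho>"
    and rho_alternating: "\<rho> x x v = 0"
    and rho_comp:
      "\<rho> x1 x2 (\<rho> x3 x4 v) =
         \<rho> (bracket x1 x2 x3) x4 v + \<rho> x3 (bracket x1 x2 x4) v + \<rho> x3 x4 (\<rho> x1 x2 v)"
    and rho_bracket:
      "\<rho> x1 (bracket x2 x3 x4) v =
         \<rho> x3 x4 (\<rho> x1 x2 v) - \<rho> x2 x4 (\<rho> x1 x3 v) + \<rho> x2 x3 (\<rho> x1 x4 v)"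

locale embedding_tensor =
  three_lie_representation scaleG bracket scaleV \<rho>
  for scaleG :: "'k::{alg_closed_field,field_char_0} \<Rightarrow> 'g::ab_group_add \<Rightarrow> 'g"
    and bracket :: "'g \<Rightarrow> 'g \<Rightarrow> 'g \<Rightarrow> 'g"
    and scaleV :: "'k \<Rightarrow> 'v::ab_group_add \<Rightarrow> 'v"
    and \<rho> :: "'g \<Rightarrow> 'g \<Rightarrow> 'v \<Rightarrow> 'v" +
  fixes T :: "'v \<Rightarrow> 'g"
  assumes T_linear: "Vector_Spaces.linear scaleV scaleG T"
    and T_bracket: "bracket (T u) (T v) (T w) = T (\<rho> (T u) (T v) w)"

locale three_leibniz_representation =
  three_leibniz_algebra scaleL bracket + W: vector_space scaleW
  for scaleL :: "'k::{alg_closed_field,field_char_0} \<Rightarrow> 'l::ab_group_add \<Rightarrow> 'l"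
    and bracket :: "'l \<Rightarrow> 'l \<Rightarrow> 'l \<Rightarrow> 'l"
    and scaleW :: "'k \<Rightarrow> 'w::ab_group_add \<Rightarrow> 'w" +
  fixes l m r :: "'l \<Rightarrow> 'l \<Rightarrow> 'w \<Rightarrow> 'w"
  assumes l_bilinear: "bilinear_to_gl scaleL scaleW l"
    and m_bilinear: "bilinear_to_gl scaleL scaleW m"
    and r_bilinear: "bilinear_to_gl scaleL scaleW r"
    and l_l:
      "l x1 x2 (l x3 x4 w) =
         l (bracket x1 x2 x3) x4 w + l x3 (bracket x1 x2 x4) w + l x3 x4 (l x1 x2 w)"
    and l_m:
      "l x1 x2 (m x3 x4 w) =
         m (bracket x1 x2 x3) x4 w + m x3 (bracket x1 x2 x4) w + m x3 x4 (l x1 x2 w)"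
    and l_r:
      "l x1 x2 (r x3 x4 w) =
         r (bracket x1 x2 x3) x4 w + r x3 (bracket x1 x2 x4) w + r x3 x4 (l x1 x2 w)"
    and m_bracket:
      "m x1 (bracket x2 x3 x4) w =
         r x3 x4 (m x1 x2 w) + m x2 x4 (m x1 x3 w) + l x2 x3 (m x1 x4 w)"
    and r_bracket:
      "r x1 (bracket x2 x3 x4) w =
         r x3 x4 (r x1 x2 w) + m x2 x4 (r x1 x3 w) + l x2 x3 (r x1 x4 w)"

definition bracket_T ::
  "('g \<Rightarrow> 'g \<Rightarrow> 'v \<Rightarrow> 'v) \<Rightarrow> ('v \<Rightarrow> 'g) \<Rightarrow> 'v \<Rightarrow> 'v \<Rightarrow> 'v \<Rightarrow> 'v" where
  "bracket_T \<rho> T u v w = \<rho> (T u) (T v) w"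

definition l_T :: "('g \<Rightarrow> 'g \<Rightarrow> 'g \<Rightarrow> 'g) \<Rightarrow> ('v \<Rightarrow> 'g) \<Rightarrow> 'v \<Rightarrow> 'v \<Rightarrow> 'g \<Rightarrow> 'g" where
  "l_T bracket T u v x = bracket (T u) (T v) x"

definition m_T ::
  "('g::ab_group_add \<Rightarrow> 'g \<Rightarrow> 'g \<Rightarrow> 'g) \<Rightarrow> ('g \<Rightarrow> 'g \<Rightarrow> 'v \<Rightarrow> 'v) \<Rightarrow> ('v \<Rightarrow> 'g) \<Rightarrow>
   'v \<Rightarrow> 'v \<Rightarrow> 'g \<Rightarrow> 'g" where
  "m_T bracket \<rho> T u v x = bracket (T u) x (T v) - T (\<rho> (T u) x v)"

definition r_T ::
  "('g::ab_group_add \<Rightarrow> 'g \<Rightarrow> 'g \<Rightarrow> 'g) \<Rightarrow> ('g \<Rightarrow> 'g \<Rightarrow> 'v \<Rightarrow> 'v) \<Rightarrow> ('v \<Rightarrow> 'g) \<Rightarrow>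
   'v \<Rightarrow> 'v \<Rightarrow> 'g \<Rightarrow> 'g" where
  "r_T bracket \<rho> T u v x = - m_T bracket \<rho> T u v x"

end

theory Submission
  imports Defs
begin

text \<open>
  On the direct sum \<open>\<gg> \<oplus> V\<close> of the 3-Lie algebra and its representation, the bracket
  \<open>[x + u, y + v, z + w] = [x, y, z] + \<rho>(x, y)w\<close> is 3-Leibniz: its \<open>V\<close>-component satisfies the
  fundamental identity by the composition law of \<open>\<rho>\<close>. The identity for \<open>T\<close> says that the graph of
  \<open>T\<close>, which is a copy of \<open>V\<close>, is a subalgebra. A subalgebra acts on the ambient algebra modulo
  itself, and the projection \<open>x + w \<mapsto> x - T w\<close> identifies the quotient with \<open>\<gg>\<close>. Placing the
  element \<open>x\<close> in the third, second or first slot of the bracket, with two elements of the graph in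
  the others, and then projecting, gives \<open>l\<^sub>T\<close>, \<open>m\<^sub>T\<close> and, since \<open>[\<cdot>, \<cdot>, \<cdot>]\<close> and \<open>\<rho>\<close> are
  skew in their first two slots, \<open>r\<^sub>T = - m\<^sub>T\<close>. Each representation axiom is the fundamental identity with four
  arguments in the graph and one outside.

  The proof carries this out without forming the sum or the quotient. The axiom for \<open>l\<^sub>T\<close>
  alone is the fundamental identity in \<open>\<gg>\<close>; each of the others is, up to sign, the difference of
  that identity and the image under \<open>T\<close> of the composition law of \<open>\<rho>\<close>. That
  the operators are well defined modulo the graph becomes the lemmas
  \<open>l_T_T\<close> and \<open>m_T_T\<close>, which describe the action on the image of \<open>T\<close> and
  absorb the correction terms \<open>T(\<dots>)\<close> produced by iterating \<open>m\<^sub>T\<close>.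
\<close>

lemmas linear_map_add = Vector_Spaces.linear.axioms(3)[THEN module_hom.add]
lemmas linear_map_scale = Vector_Spaces.linear.axioms(3)[THEN module_hom.scale]
lemmas linear_map_diff = Vector_Spaces.linear.axioms(3)[THEN module_hom.diff]
lemmas linear_map_neg = Vector_Spaces.linear.axioms(3)[THEN module_hom.neg]

context embedding_tensor
begin

lemma bracket_linear:
  shows "Vector_Spaces.linear scaleG scaleG (\<lambda>x. bracket x y z)"
    and "Vector_Spaces.linear scaleG scaleG (\<lambda>y. bracket x y z)"
    and "Vector_Spaces.linear scaleG scaleG (bracket x y)"
  using trilinear by (simp_all add: trilinear_def)

lemma rho_linear:
  shows "Vector_Spaces.linear scaleG scaleV (\<lambda>x. \<rho> x y v)"
    and "Vector_Spaces.linear scaleG scaleV (\<lambda>y. \<rho> x y v)"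
    and "Vector_Spaces.linear scaleV scaleV (\<rho> x y)"
  using rho_bilinear by (simp_all add: bilinear_to_gl_def)

lemmas additivity =
  linear_map_add[OF T_linear]
  bracket_linear[THEN linear_map_add]
  rho_linear[THEN linear_map_add]

lemmas homogeneity =
  linear_map_scale[OF T_linear]
  bracket_linear[THEN linear_map_scale]
  rho_linear[THEN linear_map_scale]

lemma rho_skew: "\<rho> y x v = - \<rho> x y v"
proof -
  have "\<rho> x y v + \<rho> y x v = \<rho> (x + y) (x + y) v"
    by (simp add: additivity rho_alternating[of x] rho_alternating[of y])
  also have "\<dots> = 0"
    by (rule rho_alternating)
  finally have "\<rho> x y v + \<rho> y x v = 0" .
  then show ?thesis
    by (simp add: eq_neg_iff_add_eq_0 add.commute)
qed

lemma T_bracket_T: "T (bracket_T \<rho> T u v w) = bracket (T u) (T v) (T w)"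
  by (simp add: bracket_T_def T_bracket)

lemma bracket_T_three_leibniz: "three_leibniz_algebra scaleV (bracket_T \<rho> T)"
proof unfold_locales
  show "trilinear scaleV (bracket_T \<rho> T)"
    unfolding trilinear_def bracket_T_def
    by (intro conjI allI rho_linear(3)
        Vector_Spaces.linear_compose[OF T_linear rho_linear(1), unfolded o_def]
        Vector_Spaces.linear_compose[OF T_linear rho_linear(2), unfolded o_def])
next
  fix x1 x2 y1 y2 y3
  show "bracket_T \<rho> T x1 x2 (bracket_T \<rho> T y1 y2 y3) =
      bracket_T \<rho> T (bracket_T \<rho> T x1 x2 y1) y2 y3 +
      bracket_T \<rho> T y1 (bracket_T \<rho> T x1 x2 y2) y3 +
      bracket_T \<rho> T y1 y2 (bracket_T \<rho> T x1 x2 y3)"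
    using rho_comp[of "T x1" "T x2" "T y1" "T y2" y3] by (simp add: bracket_T_def T_bracket)
qed

text \<open>
  Each of the three operators is a combination of compositions of the linear maps \<open>bracket\<close>, \<open>\<rho>\<close>
  and \<open>T\<close>, so additivity and homogeneity can be checked by rewriting.
\<close>

lemma bilinear_to_glI:
  fixes f :: "'v \<Rightarrow> 'v \<Rightarrow> 'g \<Rightarrow> 'g"
  assumes "\<And>u u' v x. f (u + u') v x = f u v x + f u' v x"
    and "\<And>u v v' x. f u (v + v') x = f u v x + f u v' x"
    and "\<And>u v x x'. f u v (x + x') = f u v x + f u v x'"
    and "\<And>c u v x. f (scaleV c u) v x = scaleG c (f u v x)"
    and "\<And>c u v x. f u (scaleV c v) x = scaleG c (f u v x)"
    and "\<And>c u v x. f u v (scaleG c x) = scaleG c (f u v x)"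
  shows "bilinear_to_gl scaleV scaleG f"
  unfolding bilinear_to_gl_def
  by (intro conjI allI; unfold_locales) (simp_all add: assms)

lemma l_T_bilinear: "bilinear_to_gl scaleV scaleG (l_T bracket T)"
  by (rule bilinear_to_glI) (simp_all add: l_T_def additivity homogeneity)

lemma m_T_bilinear: "bilinear_to_gl scaleV scaleG (m_T bracket \<rho> T)"
  by (rule bilinear_to_glI)
    (simp_all add: m_T_def additivity homogeneity scale_right_diff_distrib)

lemma r_T_bilinear: "bilinear_to_gl scaleV scaleG (r_T bracket \<rho> T)"
  by (rule bilinear_to_glI)
    (simp_all add: r_T_def m_T_def additivity homogeneity scale_right_diff_distrib)

lemma l_T_linear: "Vector_Spaces.linear scaleG scaleG (l_T bracket T u v)"
  using l_T_bilinear by (simp add: bilinear_to_gl_def)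

lemma m_T_linear: "Vector_Spaces.linear scaleG scaleG (m_T bracket \<rho> T u v)"
  using m_T_bilinear by (simp add: bilinear_to_gl_def)

lemmas l_T_diff = l_T_linear[THEN linear_map_diff]
lemmas m_T_diff = m_T_linear[THEN linear_map_diff]
lemmas l_T_neg = l_T_linear[THEN linear_map_neg]
lemmas m_T_neg = m_T_linear[THEN linear_map_neg]

lemma l_T_T: "l_T bracket T u v (T w) = T (\<rho> (T u) (T v) w)"
  by (simp add: l_T_def T_bracket)

lemma m_T_T: "m_T bracket \<rho> T u v (T w) = 0"
  by (simp add: m_T_def T_bracket)

text \<open>
  By skew-symmetry, \<open>r\<^sub>T\<close> arises from the bracket on \<open>\<gg> \<oplus> V\<close> by
  placing \<open>x\<close> in the first slot.
\<close>

lemma r_T_first_slot: "r_T bracket \<rho> T u v x = bracket x (T u) (T v) - T (\<rho> x (T u) v)"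
  using skew12[of "T u" x "T v"] rho_skew[of "T u" x v]
  by (simp add: r_T_def m_T_def linear_map_neg[OF T_linear])

lemma l_T_l_T:
  "l_T bracket T u1 u2 (l_T bracket T u3 u4 x) =
    l_T bracket T (bracket_T \<rho> T u1 u2 u3) u4 x + l_T bracket T u3 (bracket_T \<rho> T u1 u2 u4) x +
    l_T bracket T u3 u4 (l_T bracket T u1 u2 x)"
  using fundamental_identity[of "T u1" "T u2" "T u3" "T u4" x] by (simp add: l_T_def T_bracket_T)

lemma l_T_m_T:
  "l_T bracket T u1 u2 (m_T bracket \<rho> T u3 u4 x) =
    m_T bracket \<rho> T (bracket_T \<rho> T u1 u2 u3) u4 x +
    m_T bracket \<rho> T u3 (bracket_T \<rho> T u1 u2 u4) x +
    m_T bracket \<rho> T u3 u4 (l_T bracket T u1 u2 x)"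
proof -
  let ?a = "\<lambda>x. bracket (T u1) (T u2) x"
  have "l_T bracket T u1 u2 (m_T bracket \<rho> T u3 u4 x) =
      ?a (bracket (T u3) x (T u4)) - T (\<rho> (T u1) (T u2) (\<rho> (T u3) x u4))"
    by (simp add: m_T_def l_T_diff l_T_T) (simp add: l_T_def)
  also have "\<dots> =
      (bracket (?a (T u3)) x (T u4) + bracket (T u3) (?a x) (T u4) +
        bracket (T u3) x (?a (T u4))) -
      (T (\<rho> (?a (T u3)) x u4) + T (\<rho> (T u3) (?a x) u4) +
        T (\<rho> (T u3) x (\<rho> (T u1) (T u2) u4)))"
    by (simp only: fundamental_identity[of "T u1" "T u2" "T u3" x "T u4"]
        rho_comp[of "T u1" "T u2" "T u3" x u4] linear_map_add[OF T_linear])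
  also have "\<dots> = m_T bracket \<rho> T (bracket_T \<rho> T u1 u2 u3) u4 x +
      m_T bracket \<rho> T u3 (bracket_T \<rho> T u1 u2 u4) x +
      m_T bracket \<rho> T u3 u4 (l_T bracket T u1 u2 x)"
    unfolding m_T_def l_T_def T_bracket_T by (simp add: bracket_T_def)
  finally show ?thesis .
qed

text \<open>
  Here \<open>x\<close> is one of the two acting arguments of the fundamental identity, so every term on the
  right contains some \<open>bracket (T u1) x (T ui)\<close>, which agrees with \<open>m\<^sub>T(u1, ui)x\<close> modulo the
  image of \<open>T\<close>. The operators \<open>r\<^sub>T\<close> and \<open>m\<^sub>T\<close> do not see the difference, and \<open>l\<^sub>T\<close> turns it
  into the last term of the composition law of \<open>\<rho>\<close>.
\<close>

lemma m_T_bracket_T: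
  "m_T bracket \<rho> T u1 (bracket_T \<rho> T u2 u3 u4) x =
    r_T bracket \<rho> T u3 u4 (m_T bracket \<rho> T u1 u2 x) +
    m_T bracket \<rho> T u2 u4 (m_T bracket \<rho> T u1 u3 x) +
    l_T bracket T u2 u3 (m_T bracket \<rho> T u1 u4 x)"
proof -
  let ?b = "\<lambda>y. bracket (T u1) x y"
  have "m_T bracket \<rho> T u1 (bracket_T \<rho> T u2 u3 u4) x =
      ?b (bracket (T u2) (T u3) (T u4)) - T (\<rho> (T u1) x (\<rho> (T u2) (T u3) u4))"
    unfolding m_T_def T_bracket_T by (simp add: bracket_T_def)
  also have "\<dots> =
      (bracket (?b (T u2)) (T u3) (T u4) + bracket (T u2) (?b (T u3)) (T u4) +
        bracket (T u2) (T u3) (?b (T u4))) -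
      (T (\<rho> (?b (T u2)) (T u3) u4) + T (\<rho> (T u2) (?b (T u3)) u4) +
        T (\<rho> (T u2) (T u3) (\<rho> (T u1) x u4)))"
    by (simp only: fundamental_identity[of "T u1" x "T u2" "T u3" "T u4"]
        rho_comp[of "T u1" x "T u2" "T u3" u4] linear_map_add[OF T_linear])
  also have "\<dots> = r_T bracket \<rho> T u3 u4 (?b (T u2)) + m_T bracket \<rho> T u2 u4 (?b (T u3)) +
      l_T bracket T u2 u3 (m_T bracket \<rho> T u1 u4 x)"
    unfolding r_T_first_slot m_T_def l_T_diff l_T_T unfolding l_T_def by simp
  also have "r_T bracket \<rho> T u3 u4 (?b (T u2)) =
      r_T bracket \<rho> T u3 u4 (m_T bracket \<rho> T u1 u2 x)"
    by (simp add: r_T_def m_T_def[of _ _ _ u1] m_T_diff m_T_T)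
  also have "m_T bracket \<rho> T u2 u4 (?b (T u3)) =
      m_T bracket \<rho> T u2 u4 (m_T bracket \<rho> T u1 u3 x)"
    by (simp add: m_T_def[of _ _ _ u1] m_T_diff m_T_T)
  finally show ?thesis .
qed

end

theorem lemma4p3:
  fixes scaleG :: "'k::{alg_closed_field,field_char_0} \<Rightarrow> 'g::ab_group_add \<Rightarrow> 'g"
    and bracket :: "'g \<Rightarrow> 'g \<Rightarrow> 'g \<Rightarrow> 'g"
    and scaleV :: "'k \<Rightarrow> 'v::ab_group_add \<Rightarrow> 'v"
    and \<rho> :: "'g \<Rightarrow> 'g \<Rightarrow> 'v \<Rightarrow> 'v"
    and T :: "'v \<Rightarrow> 'g"
  assumes "embedding_tensor scaleG bracket scaleV \<rho> T"
  shows "three_leibniz_representation scaleV (bracket_T \<rho> T) scaleG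
           (l_T bracket T) (m_T bracket \<rho> T) (r_T bracket \<rho> T)"
proof -
  interpret embedding_tensor scaleG bracket scaleV \<rho> T
    by (rule assms)
  interpret VT: three_leibniz_algebra scaleV "bracket_T \<rho> T"
    by (rule bracket_T_three_leibniz)
  show ?thesis
  proof unfold_locales
    fix u1 u2 u3 u4 x
    show "l_T bracket T u1 u2 (r_T bracket \<rho> T u3 u4 x) =
        r_T bracket \<rho> T (bracket_T \<rho> T u1 u2 u3) u4 x +
        r_T bracket \<rho> T u3 (bracket_T \<rho> T u1 u2 u4) x +
        r_T bracket \<rho> T u3 u4 (l_T bracket T u1 u2 x)"
      by (simp add: r_T_def l_T_neg l_T_m_T)
    show "r_T bracket \<rho> T u1 (bracket_T \<rho> T u2 u3 u4) x =
        r_T bracket \<rho> T u3 u4 (r_T bracket \<rho> T u1 u2 x) +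
        m_T bracket \<rho> T u2 u4 (r_T bracket \<rho> T u1 u3 x) +
        l_T bracket T u2 u3 (r_T bracket \<rho> T u1 u4 x)"
      by (simp add: r_T_def l_T_neg m_T_neg m_T_bracket_T)
  qed (fact l_T_bilinear m_T_bilinear r_T_bilinear l_T_l_T l_T_m_T m_T_bracket_T)+
qed

end
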